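(* Let $A\in\mathbb{S}^{n_r\times n_r}$, $A\ne 0$. The halfspace $\{X\in\mathbb{S}^{n_r\times n_r}:\langle A, X \rangle \geq 0\}$ is maximal outer-product-free if and only if $A$ is negative semidefinite.
   Context: $\mathbb{S}^{n_r\times n_r}$ is the space of real symmetric $n_r\times n_r$ matrices, where $n_r=\binom{n+r}{r}$ for integers $n,r\ge 1$, with the matrix inner product $\langle\cdot,\cdot\rangle$ (trace inner product). Let $S_{OP}:=\{X\in\mathbb{S}^{n_r\times n_r}: X=xx^T,\ x\in\mathbb{R}^{n_r}\}$. A set $C\subseteq\mathbb{S}^{n_r\times n_r}$ is outer-product-free if it is closed and convex and $\mathrm{int}(C)\cap S_{OP}=\emptyset$. An outer-product-free set is maximal if it is not strictly contained in any other outer-product-free set. *)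

theory Defs
  imports "HOL-Analysis.Analysis"
begin

definition sym_matrices :: "(real ^ 'm ^ 'm) set" where
  "sym_matrices = {X. transpose X = X}"

definition trace_inner :: "real ^ 'm ^ 'm \<Rightarrow> real ^ 'm ^ 'm \<Rightarrow> real" where
  "trace_inner A X = trace (transpose A ** X)"

definition neg_semidefinite :: "real ^ 'm ^ 'm \<Rightarrow> bool" where
  "neg_semidefinite A \<longleftrightarrow> A \<in> sym_matrices \<and> (\<forall>x. x \<bullet> (A *v x) \<le> 0)"

definition S_OP :: "(real ^ 'm ^ 'm) set" where
  "S_OP = {X \<in> sym_matrices. \<exists>x :: real ^ 'm.
     X = (columnvector x :: real ^ 1 ^ 'm) ** transpose (columnvector x)}"

text \<open>
  The type annotation above is essential: the number of columns of \<open>columnvector x\<close> is otherwise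
  an independent type variable, and the product would be scaled by that number.
\<close>

text \<open>
  The ambient space is the space of symmetric matrices, so closedness and interior refer to the
  subspace topology. The type-class interior in the space of all square matrices would be the
  wrong notion: for at least two rows, a set of symmetric matrices has empty interior there.
\<close>

definition outer_product_free :: "(real ^ 'm ^ 'm) set \<Rightarrow> bool" where
  "outer_product_free C \<longleftrightarrow>
     C \<subseteq> sym_matrices \<and> closedin (top_of_set sym_matrices) C \<and> convex C \<and>
     (top_of_set sym_matrices interior_of C) \<inter> S_OP = {}"

definition maximal_outer_product_free :: "(real ^ 'm ^ 'm) set \<Rightarrow> bool" where
  "maximal_outer_product_free C \<longleftrightarrow>
     outer_product_free C \<and> \<not> (\<exists>D. outer_product_free D \<and> C \<subset> D)"

lemma trace_inner_eq_inner: "trace_inner A X = A \<bullet> X"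
proof -
  have "trace_inner A X = (\<Sum>i\<in>UNIV. \<Sum>k\<in>UNIV. A $ k $ i * X $ k $ i)"
    by (simp add: trace_inner_def trace_def matrix_matrix_mult_def transpose_def)
  also have "\<dots> = (\<Sum>k\<in>UNIV. \<Sum>i\<in>UNIV. A $ k $ i * X $ k $ i)"
    by (rule sum.swap)
  finally show ?thesis
    by (simp add: inner_vec_def)
qed

lemma outer_product_nth:
  fixes x :: "real ^ 'm"
  shows "((columnvector x :: real ^ 1 ^ 'm) ** transpose (columnvector x)) $ i $ j = x $ i * x $ j"
  by (simp add: columnvector_def transpose_def matrix_matrix_mult_def)

end

theory Submission
  imports Defs
begin

text \<open>
  For an outer product \<open>x x\<^sup>T\<close> the trace inner product with \<open>A\<close> is the quadratic form
  \<open>x \<bullet> (A *v x)\<close>. Since \<open>A\<close> is a nonzero element of the space of symmetric matrices, the interior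
  of the halfspace relative to that space is the open halfspace \<open>A \<bullet> X > 0\<close>. Hence the
  halfspace contains no outer product in its interior exactly when \<open>A\<close> is negative semidefinite
  (\<open>outer_product_free_halfspace_iff\<close>).

  Maximality is then automatic, because the matrix \<open>0\<close> is itself an outer product and lies on the
  boundary of the halfspace. A strictly larger convex set contains some \<open>Y\<close> with
  \<open>A \<bullet> Y < 0\<close>, and averaging \<open>Y\<close> with points of the halfspace yields a whole neighbourhood of
  \<open>0\<close> (\<open>zero_in_interior_of_convex_superset\<close>).
\<close>

lemma subspace_sym_matrices: "subspace sym_matrices"
  by (auto simp: subspace_def sym_matrices_def transpose_def vec_eq_iff)

lemma outer_product_in_S_OP:
  fixes x :: "real ^ 'm"
  shows "(columnvector x :: real ^ 1 ^ 'm) ** transpose (columnvector x) \<in> S_OP"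
  by (auto simp: S_OP_def sym_matrices_def matrix_transpose_mul)

lemma zero_in_S_OP: "0 \<in> (S_OP :: (real ^ 'm ^ 'm) set)"
proof -
  let ?x = "0 :: real ^ 'm"
  have "(columnvector ?x :: real ^ 1 ^ 'm) ** transpose (columnvector ?x) = 0"
    by (simp add: vec_eq_iff outer_product_nth)
  then show ?thesis
    using outer_product_in_S_OP[of ?x] by metis
qed

lemma inner_outer_product:
  fixes A :: "real ^ 'm ^ 'm" and x :: "real ^ 'm"
  shows "A \<bullet> ((columnvector x :: real ^ 1 ^ 'm) ** transpose (columnvector x)) = x \<bullet> (A *v x)"
  by (simp add: inner_vec_def outer_product_nth matrix_vector_mult_def sum_distrib_left mult_ac)

lemma openin_subspace_halfspace_gt:
  fixes a :: "'a :: euclidean_space"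
  shows "openin (top_of_set S) {x \<in> S. a \<bullet> x > c}"
proof -
  have "{x \<in> S. a \<bullet> x > c} = S \<inter> {x. a \<bullet> x > c}" by auto
  then show ?thesis
    by (simp add: openin_open_Int open_halfspace_gt)
qed

text \<open>
  The normal vector has to lie in the subspace: it supplies the direction \<open>- a\<close> in which a boundary
  point can be moved out of the halfspace without leaving the subspace.
\<close>

lemma interior_of_subspace_halfspace:
  fixes a :: "'a :: euclidean_space"
  assumes S: "subspace S" and a: "a \<in> S" "a \<noteq> 0"
  shows "top_of_set S interior_of {x \<in> S. a \<bullet> x \<ge> 0} = {x \<in> S. a \<bullet> x > 0}"
proof
  show "{x \<in> S. a \<bullet> x > 0} \<subseteq> top_of_set S interior_of {x \<in> S. a \<bullet> x \<ge> 0}"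
    by (rule interior_of_maximal) (auto simp: openin_subspace_halfspace_gt)
next
  show "top_of_set S interior_of {x \<in> S. a \<bullet> x \<ge> 0} \<subseteq> {x \<in> S. a \<bullet> x > 0}"
  proof
    fix x assume "x \<in> top_of_set S interior_of {x \<in> S. a \<bullet> x \<ge> 0}"
    then obtain T where T: "openin (top_of_set S) T" "x \<in> T" "T \<subseteq> {x \<in> S. a \<bullet> x \<ge> 0}"
      by (auto simp: interior_of_def)
    then obtain e where e: "e > 0" "ball x e \<inter> S \<subseteq> T"
      by (auto simp: openin_contains_ball)
    have xS: "x \<in> S" using T by auto
    define t where "t = e / (2 * norm a)"
    have t: "t > 0" using e a by (simp add: t_def)
    have "x - t *\<^sub>R a \<in> S"
      using S a xS by (simp add: subspace_diff subspace_scale)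
    moreover have "x - t *\<^sub>R a \<in> ball x e"
      using e a by (simp add: t_def dist_norm)
    ultimately have "a \<bullet> (x - t *\<^sub>R a) \<ge> 0"
      using e(2) T(3) by blast
    then have "a \<bullet> x \<ge> t * (a \<bullet> a)"
      by (simp add: inner_diff_right)
    moreover have "t * (a \<bullet> a) > 0"
      using t a by simp
    ultimately show "x \<in> {x \<in> S. a \<bullet> x > 0}"
      using xS by simp
  qed
qed

text \<open>
  Every \<open>x\<close> is the midpoint of \<open>y\<close> and its reflection \<open>2 x - y\<close>; for \<open>x\<close> near \<open>0\<close> that
  reflection is near \<open>- y\<close>, which is an inner point of the halfspace.
\<close>

lemma zero_in_interior_of_convex_superset:
  fixes a :: "'a :: euclidean_space"
  assumes S: "subspace S" and D: "convex D" "{x \<in> S. a \<bullet> x \<ge> 0} \<subseteq> D"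
    and y: "y \<in> D" "y \<in> S" "a \<bullet> y < 0"
  shows "0 \<in> top_of_set S interior_of D"
proof -
  let ?T = "{x \<in> S. a \<bullet> x > (a \<bullet> y) / 2}"
  have "?T \<subseteq> D"
  proof
    fix x assume x: "x \<in> ?T"
    have "2 *\<^sub>R x - y \<in> S"
      using S x y by (simp add: subspace_diff subspace_scale)
    moreover have "a \<bullet> (2 *\<^sub>R x - y) \<ge> 0"
      using x by (simp add: inner_diff_right)
    ultimately have "2 *\<^sub>R x - y \<in> D"
      using D by auto
    then have "(1/2) *\<^sub>R y + (1/2) *\<^sub>R (2 *\<^sub>R x - y) \<in> D"
      using D(1) y(1) by (intro convexD) auto
    then show "x \<in> D"
      by (simp add: algebra_simps)
  qed
  then have "?T \<subseteq> top_of_set S interior_of D"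
    by (intro interior_of_maximal openin_subspace_halfspace_gt)
  moreover have "0 \<in> ?T"
    using S y by (simp add: subspace_0)
  ultimately show ?thesis by blast
qed

lemma outer_product_free_halfspace_iff:
  fixes A :: "real ^ 'm ^ 'm"
  assumes A: "A \<in> sym_matrices" "A \<noteq> 0"
  shows "outer_product_free {X \<in> sym_matrices. A \<bullet> X \<ge> 0} \<longleftrightarrow> neg_semidefinite A"
proof -
  let ?H = "{X \<in> sym_matrices. A \<bullet> X \<ge> 0}"
  have H: "?H = sym_matrices \<inter> {X. A \<bullet> X \<ge> 0}" by auto
  have "closedin (top_of_set sym_matrices) ?H"
    unfolding H by (simp add: closedin_closed_Int closed_halfspace_ge)
  moreover have "convex ?H"
    unfolding H by (intro convex_Int subspace_imp_convex subspace_sym_matrices convex_halfspace_ge)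
  ultimately have "outer_product_free ?H \<longleftrightarrow> {X \<in> sym_matrices. A \<bullet> X > 0} \<inter> S_OP = {}"
    by (auto simp: outer_product_free_def
        interior_of_subspace_halfspace[OF subspace_sym_matrices A])
  also have "\<dots> \<longleftrightarrow> (\<forall>X \<in> S_OP. A \<bullet> X \<le> 0)"
    by (force simp: S_OP_def not_le)
  also have "\<dots> \<longleftrightarrow> (\<forall>x. x \<bullet> (A *v x) \<le> 0)"
  proof
    assume "\<forall>X \<in> S_OP. A \<bullet> X \<le> 0"
    then show "\<forall>x. x \<bullet> (A *v x) \<le> 0"
      using outer_product_in_S_OP inner_outer_product by metis
  next
    assume "\<forall>x. x \<bullet> (A *v x) \<le> 0"
    then show "\<forall>X \<in> S_OP. A \<bullet> X \<le> 0"
      by (auto simp: S_OP_def inner_outer_product)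
  qed
  finally show ?thesis
    using A by (simp add: neg_semidefinite_def)
qed

theorem theorem19:
  fixes n r :: nat and A :: "real ^ 'm ^ 'm"
  assumes "n \<ge> 1" and "r \<ge> 1"
    and "CARD('m) = (n + r) choose r"
    and "A \<in> sym_matrices" and "A \<noteq> 0"
  shows "maximal_outer_product_free {X \<in> sym_matrices. trace_inner A X \<ge> 0}
           \<longleftrightarrow> neg_semidefinite A"
proof -
  let ?H = "{X \<in> sym_matrices. A \<bullet> X \<ge> 0}"
  have "\<not> outer_product_free D" if D: "?H \<subset> D" for D
  proof
    assume free: "outer_product_free D"
    then have "D \<subseteq> sym_matrices" "convex D"
      by (auto simp: outer_product_free_def)
    moreover obtain Y where "Y \<in> D" "Y \<notin> ?H"
      using D by blast
    ultimately have "0 \<in> top_of_set sym_matrices interior_of D"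
      using D by (intro zero_in_interior_of_convex_superset[where a = A and y = Y])
        (auto simp: subspace_sym_matrices)
    then show False
      using free zero_in_S_OP by (auto simp: outer_product_free_def)
  qed
  then have "maximal_outer_product_free ?H \<longleftrightarrow> outer_product_free ?H"
    by (auto simp: maximal_outer_product_free_def)
  then show ?thesis
    using assms(4,5) by (simp add: trace_inner_eq_inner outer_product_free_halfspace_iff)
qed

end
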